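(* Consider the combined heat and power network under Mode 1 (described in the context), with constant electrical loads $p^L$ and heat loads $h^L$. At an equilibrium of the system (reached after a step change in the electrical load $p^L$), the following hold. (i) The equilibrium deviations of power generation $p^G$ and heat pump load $p^P$ (together with $p^U$, $p^U_j=D_j\omega_j$) are the solution of the optimization problem $$\min_{p^G,p^P,p^U}\ \tfrac12(p^G)^TQ_ep^G+\tfrac12(p^P)^TQ_pp^P+\tfrac12(p^U)^TQ_up^U\quad\text{s.t.}\quad \mathbf 1^Tp^G=\mathbf 1^Tp^L+\mathbf 1^Tp^P+\mathbf 1^Tp^U,$$ where $Q_e=\mathrm{diag}(\{Q_{e,jj}\})_{j\in N_e^G}$, $Q_p=\mathrm{diag}(\{Q_{p,jj}\})$ with $Q_{p,jj}=\frac1{a_{1,j}}$, $j\in H_e$, and $Q_u=\mathrm{diag}(\{Q_{u,jj}\})$ with $Q_{u,jj}=\frac1{D_j}$, $j\in N_e$. (ii) Given the heat pump power deviation $h^P$ corresponding to the solution of the problem in (i) (that is, $h^P_{k_j}=C_{o,j}p^P_j$, $j\in H_e$), the equilibrium deviation $h^G$ of the power of the conventional heat sources is the solution of the optimization problem $$\min_{h^G}\ \tfrac12(h^G)^TQ_hh^G\quad\text{s.t.}\quad \mathbf 1^Th^G=\mathbf 1^T(h^L-h^P),$$ where $Q_h=\mathrm{diag}(\{Q_{h,jj}\})_{j\in E_h^G}$.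
   Context: **Electric network.** $(N_e,E_e)$ is a finite connected directed graph; $N_e$ is the set of buses, $E_e\subseteq N_e\times N_e$ the set of transmission lines. $N_e^G\subseteq N_e$ is the set of generator buses, $H_e\subseteq N_e$ the set of buses to which heat pumps are connected. For each bus $j\in N_e$, $$M_j\dot\omega_j=-p^L_j-p^P_j+p^G_j-p^U_j+\sum_{i:\,i\to j}p_{ij}-\sum_{k:\,j\to k}p_{jk},$$ and for each line $(i,j)\in E_e$, $\dot\eta_{ij}=\omega_i-\omega_j$, $p_{ij}=B_{ij}\sin(\eta_{ij})$ with $B_{ij}>0$. Here $\omega_j$ is the frequency deviation at bus $j$, $\eta_{ij}$ the angle difference between buses $i$ and $j$, $p^U_j=D_j\omega_j$ with $D_j>0$, $p^L_j$ is a constant load, $p^P_j$ is the heat pump consumption ($p^P_j=0$ if $j\notin H_e$), $p^G_j$ is the generation. If $j\in N_e^G$ then $M_j>0$; if $j$ is a load bus, $M_j=0$ and $p^G_j=0$. **Heating network.** $(N_h,E_h)$ is a finite directed graph with nodes $N_h$ and edges $E_h$; $H_h\subseteq E_h$ are the edges carrying heat pumps, $E_h^G\subseteq E_h$ those carrying conventional heat sources, $E_h^L\subseteq E_h$ those carrying heat loads. With $T=\mathrm{col}(T^E,T^N)$ the vector of edge and node temperature deviations, $$V\dot T=-A_hT+\begin{bmatrix}h^G+h^P-h^L\\ \mathbf 0\end{bmatrix},\qquad A_h=\begin{bmatrix}\mathrm{diag}(q^E)&-\mathrm{diag}(q^E)B_{sh}^T\\-B_{th}\mathrm{diag}(q^E)&\mathrm{diag}(B_{th}q^E)\end{bmatrix},$$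 where $V=\mathrm{diag}(\{V^E_j\},\{V^N_k\})$ has positive volumes on the diagonal, $q^E$ is a given constant vector of edge mass flows, $B_h$ is the incidence matrix ($B_{h,ij}=1$ if the flow through edge $j$ enters node $i$, $-1$ if it originates from node $i$, $0$ otherwise), $B_{th}=\frac12(|B_h|+B_h)$, $B_{sh}=\frac12(|B_h|-B_h)$ (entrywise absolute value). $h^P,h^G,h^L\in\mathbb R^{E_h}$ are supported on $H_h$, $E_h^G$, $E_h^L$ respectively, and $h^L$ is constant. The matrix $A_h$ satisfies: $A_h+A_h^T$ is positive semidefinite with a simple eigenvalue at $0$, $A_h\mathbf 1=0$, $\mathbf 1^TA_h=0$. The average temperature is $\bar T=\frac{\mathbf 1^TVT}{\mathcal V}$ with $\mathcal V=\mathbf 1^TV\mathbf 1$. **Generation control.** With positive constants $\tau_{e,j},Q_{e,jj},\tau_{h,j},Q_{h,jj}$ and $\tilde Q_{e,jj}=1/Q_{e,jj}$, $\tilde Q_{h,jj}=1/Q_{h,jj}$: $$\tau_{e,j}\dot p^G_j=-p^G_j-\tilde Q_{e,jj}\omega_j,\ j\in N_e^G;\qquad \tau_{h,j}\dot h^G_j=-h^G_j-\tilde Q_{h,jj}\bar T,\ j\in E_h^G.$$ **Heat pumps (Mode 1).** Each $j\in H_e$ is associated with an edge $k_j\in H_h$ (a one-to-one correspondence), $h^P_{k_j}=C_{o,j}p^P_j$ with constant $C_{o,j}>0$, and $p^P_j=a_{1,j}\omega_j$ with constants $a_{1,j}>0$. **Conventions.** An equilibrium is a point $(\eta,\omega,p^G,T,h^G)$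 at which all these variables are constant in time; at an equilibrium all bus frequencies are equal. In the optimization problems, $p^G$ is indexed by $N_e^G$, $p^P$ by $H_e$, $p^U$ by $N_e$, $h^G$ by $E_h^G$ (other entries are zero), and $\mathbf 1$ is the all-ones vector of appropriate dimension. *)

theory Defs
  imports
    "HOL-Analysis.Analysis"
    "HOL-Computational_Algebra.Polynomial"
    "Graph_Theory.Pair_Digraph"
    "Graph_Theory.Digraph_Component"
begin

definition diag :: "'a::zero ^ 'n \<Rightarrow> 'a ^ 'n ^ 'n" where
  "diag v = (\<chi> i j. if i = j then v $ i else 0)"

definition block_matrix ::
  "'a ^ 'n ^ 'm \<Rightarrow> 'a ^ 'q ^ 'm \<Rightarrow> 'a ^ 'n ^ 'p \<Rightarrow> 'a ^ 'q ^ 'p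
    \<Rightarrow> 'a ^ ('n::finite + 'q::finite) ^ ('m::finite + 'p::finite)" where
  "block_matrix A B C D = (\<chi> i j. case i of
       Inl k \<Rightarrow> (case j of Inl l \<Rightarrow> A $ k $ l | Inr l \<Rightarrow> B $ k $ l)
     | Inr k \<Rightarrow> (case j of Inl l \<Rightarrow> C $ k $ l | Inr l \<Rightarrow> D $ k $ l))"

definition col :: "'a ^ 'm \<Rightarrow> 'a ^ 'n \<Rightarrow> 'a ^ ('m::finite + 'n::finite)" where
  "col u v = (\<chi> i. case i of Inl k \<Rightarrow> u $ k | Inr k \<Rightarrow> v $ k)"

text \<open>The determinant of \<open>X I - A\<close>, taken over the polynomial ring.\<close>
definition charpoly :: "'a::comm_ring_1 ^ 'n ^ 'n \<Rightarrow> 'a poly" where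
  "charpoly A = det (mat [:0, 1:] - (\<chi> i j. [:A $ i $ j:]))"

definition simple_eigenvalue :: "'a::idom ^ 'n ^ 'n \<Rightarrow> 'a \<Rightarrow> bool" where
  "simple_eigenvalue A c \<longleftrightarrow> order c (charpoly A) = 1"

definition pos_semidef :: "real ^ 'n ^ 'n \<Rightarrow> bool" where
  "pos_semidef A \<longleftrightarrow> transpose A = A \<and> (\<forall>x. 0 \<le> x \<bullet> (A *v x))"

text \<open>
  The sets \<open>N\<^sub>e\<close>, \<open>N\<^sub>h\<close>, \<open>E\<^sub>h\<close> are the finite types \<open>'b\<close>, \<open>'v\<close>, \<open>'e\<close>; the subsets
  \<open>E\<^sub>e\<close>, \<open>N\<^sub>e\<^sup>G\<close>, \<open>H\<^sub>e\<close>, \<open>H\<^sub>h\<close>, \<open>E\<^sub>h\<^sup>G\<close>, \<open>E\<^sub>h\<^sup>L\<close> are \<open>lines\<close>, \<open>gen_buses\<close>, \<open>hp_buses\<close>, \<open>hp_edges\<close>,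
  \<open>source_edges\<close>, \<open>load_edges\<close>. A vector indexed by a subset is a vector over the whole
  type that vanishes off the subset.
\<close>
record ('b::finite, 'v::finite, 'e::finite) chp_network =
  lines :: "('b \<times> 'b) set"
  gen_buses :: "'b set"
  hp_buses :: "'b set"
  inertia :: "'b \<Rightarrow> real"                (* M *)
  damping :: "'b \<Rightarrow> real"                (* D *)
  suscept :: "'b \<times> 'b \<Rightarrow> real"          (* B *)
  elec_load :: "real ^ 'b"               (* p^L *)
  tau_e :: "'b \<Rightarrow> real"
  Q_e :: "'b \<Rightarrow> real"
  edge_src :: "'e \<Rightarrow> 'v"
  edge_tgt :: "'e \<Rightarrow> 'v"
  hp_edges :: "'e set"
  source_edges :: "'e set"
  load_edges :: "'e set"
  edge_vol :: "real ^ 'e"                (* V^E *)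
  node_vol :: "real ^ 'v"                (* V^N *)
  mass_flow :: "real ^ 'e"               (* q^E *)
  heat_load :: "real ^ 'e"               (* h^L *)
  tau_h :: "'e \<Rightarrow> real"
  Q_h :: "'e \<Rightarrow> real"
  hp_edge :: "'b \<Rightarrow> 'e"                  (* j \<mapsto> k_j *)
  hp_cop :: "'b \<Rightarrow> real"                 (* C_o *)
  hp_gain :: "'b \<Rightarrow> real"                (* a_1 *)

text \<open>
  Edges are oriented along the flow. Self-loops, for which the entry is ambiguous, are
  excluded by the conditions on \<open>A_h\<close> below: they would force the mass flow of the loop
  to vanish and the eigenvalue 0 to be multiple.
\<close>
definition incidence :: "('b::finite, 'v::finite, 'e::finite) chp_network \<Rightarrow> real ^ 'e ^ 'v" where
  "incidence N = (\<chi> i j. if edge_tgt N j = i then 1 else if edge_src N j = i then - 1 else 0)"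

definition B_th :: "('b::finite, 'v::finite, 'e::finite) chp_network \<Rightarrow> real ^ 'e ^ 'v" where
  "B_th N = (1 / 2) *\<^sub>R ((\<chi> i j. \<bar>incidence N $ i $ j\<bar>) + incidence N)"

definition B_sh :: "('b::finite, 'v::finite, 'e::finite) chp_network \<Rightarrow> real ^ 'e ^ 'v" where
  "B_sh N = (1 / 2) *\<^sub>R ((\<chi> i j. \<bar>incidence N $ i $ j\<bar>) - incidence N)"

definition A_h ::
  "('b::finite, 'v::finite, 'e::finite) chp_network \<Rightarrow> real ^ ('e + 'v) ^ ('e + 'v)" where
  "A_h N = block_matrix
     (diag (mass_flow N))                (- (diag (mass_flow N) ** transpose (B_sh N)))
     (- (B_th N ** diag (mass_flow N)))  (diag (B_th N *v mass_flow N))"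

definition vol_matrix ::
  "('b::finite, 'v::finite, 'e::finite) chp_network \<Rightarrow> real ^ ('e + 'v) ^ ('e + 'v)" where
  "vol_matrix N = diag (col (edge_vol N) (node_vol N))"

definition avg_temp ::
  "('b::finite, 'v::finite, 'e::finite) chp_network \<Rightarrow> real ^ ('e + 'v) \<Rightarrow> real" where
  "avg_temp N T = (1 \<bullet> (vol_matrix N *v T)) / (1 \<bullet> (vol_matrix N *v 1))"

definition chp_wf :: "('b::finite, 'v::finite, 'e::finite) chp_network \<Rightarrow> bool" where
  "chp_wf N \<longleftrightarrow>
     Digraph_Component.connected (with_proj \<lparr>pverts = UNIV, parcs = lines N\<rparr>) \<and>
     (\<forall>l\<in>lines N. suscept N l > 0) \<and>
     (\<forall>j\<in>gen_buses N. inertia N j > 0) \<and>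
     (\<forall>j. j \<notin> gen_buses N \<longrightarrow> inertia N j = 0) \<and>
     (\<forall>j. damping N j > 0) \<and>
     (\<forall>j\<in>gen_buses N. tau_e N j > 0 \<and> Q_e N j > 0) \<and>
     (\<forall>j. edge_vol N $ j > 0) \<and>
     (\<forall>k. node_vol N $ k > 0) \<and>
     (\<forall>j. j \<notin> load_edges N \<longrightarrow> heat_load N $ j = 0) \<and>
     (\<forall>j\<in>source_edges N. tau_h N j > 0 \<and> Q_h N j > 0) \<and>
     pos_semidef (A_h N + transpose (A_h N)) \<and>
     simple_eigenvalue (A_h N + transpose (A_h N)) 0 \<and>
     A_h N *v 1 = 0 \<and>
     1 v* A_h N = 0 \<and>
     bij_betw (hp_edge N) (hp_buses N) (hp_edges N) \<and>
     (\<forall>j\<in>hp_buses N. hp_cop N j > 0 \<and> hp_gain N j > 0)"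

record ('b::finite, 'v::finite, 'e::finite) chp_state =
  angle :: "real ^ ('b \<times> 'b)"            (* eta; only entries at lines are meaningful *)
  freq :: "real ^ 'b"                    (* omega *)
  elec_gen :: "real ^ 'b"                (* p^G *)
  temp :: "real ^ ('e + 'v)"             (* T = col(T^E, T^N) *)
  heat_gen :: "real ^ 'e"                (* h^G *)

definition line_flow ::
  "('b::finite, 'v::finite, 'e::finite) chp_network \<Rightarrow> real ^ ('b \<times> 'b) \<Rightarrow> 'b \<Rightarrow> 'b \<Rightarrow> real" where
  "line_flow N eta i j = suscept N (i, j) * sin (eta $ (i, j))"

definition damping_power ::
  "('b::finite, 'v::finite, 'e::finite) chp_network \<Rightarrow> real ^ 'b \<Rightarrow> real ^ 'b" where
  "damping_power N w = (\<chi> j. damping N j * w $ j)"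

definition hp_power ::
  "('b::finite, 'v::finite, 'e::finite) chp_network \<Rightarrow> real ^ 'b \<Rightarrow> real ^ 'b" where
  "hp_power N w = (\<chi> j. if j \<in> hp_buses N then hp_gain N j * w $ j else 0)"

definition hp_heat ::
  "('b::finite, 'v::finite, 'e::finite) chp_network \<Rightarrow> real ^ 'b \<Rightarrow> real ^ 'e" where
  "hp_heat N pP = (\<chi> k. if k \<in> hp_edges N
     then (let j = the_inv_into (hp_buses N) (hp_edge N) k in hp_cop N j * pP $ j) else 0)"

text \<open>
  In the bus equation, \<open>d\<close> is the derivative of \<open>\<omega>\<^sub>j\<close> at generator buses. At a load bus
  \<open>M\<^sub>j = 0\<close>, so the equation is algebraic there and no differentiability is required.
\<close>
definition mode1_solution ::
  "('b::finite, 'v::finite, 'e::finite) chp_network \<Rightarrow> (real \<Rightarrow> ('b, 'v, 'e) chp_state) \<Rightarrow> bool" where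
  "mode1_solution N x \<longleftrightarrow> (\<forall>t.
     (\<forall>(i, j)\<in>lines N.
        ((\<lambda>s. angle (x s) $ (i, j)) has_real_derivative freq (x t) $ i - freq (x t) $ j) (at t)) \<and>
     (\<forall>j. \<exists>d.
        (j \<in> gen_buses N \<longrightarrow> ((\<lambda>s. freq (x s) $ j) has_real_derivative d) (at t)) \<and>
        inertia N j * d =
          - elec_load N $ j - hp_power N (freq (x t)) $ j + elec_gen (x t) $ j
          - damping_power N (freq (x t)) $ j
          + (\<Sum>i | (i, j) \<in> lines N. line_flow N (angle (x t)) i j)
          - (\<Sum>k | (j, k) \<in> lines N. line_flow N (angle (x t)) j k)) \<and>
     (\<forall>j. j \<notin> gen_buses N \<longrightarrow> elec_gen (x t) $ j = 0) \<and>
     (\<forall>j\<in>gen_buses N. \<exists>d.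
        ((\<lambda>s. elec_gen (x s) $ j) has_real_derivative d) (at t) \<and>
        tau_e N j * d = - elec_gen (x t) $ j - (1 / Q_e N j) * freq (x t) $ j) \<and>
     (\<exists>d. ((\<lambda>s. temp (x s)) has_vector_derivative d) (at t) \<and>
        vol_matrix N *v d =
          - (A_h N *v temp (x t))
          + col (heat_gen (x t) + hp_heat N (hp_power N (freq (x t))) - heat_load N) 0) \<and>
     (\<forall>j. j \<notin> source_edges N \<longrightarrow> heat_gen (x t) $ j = 0) \<and>
     (\<forall>j\<in>source_edges N. \<exists>d.
        ((\<lambda>s. heat_gen (x s) $ j) has_real_derivative d) (at t) \<and>
        tau_h N j * d = - heat_gen (x t) $ j - (1 / Q_h N j) * avg_temp N (temp (x t))))"

definition mode1_equilibrium ::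
  "('b::finite, 'v::finite, 'e::finite) chp_network \<Rightarrow> ('b, 'v, 'e) chp_state \<Rightarrow> bool" where
  "mode1_equilibrium N x \<longleftrightarrow> mode1_solution N (\<lambda>t. x)"

definition is_unique_minimizer :: "('a \<Rightarrow> real) \<Rightarrow> ('a \<Rightarrow> bool) \<Rightarrow> 'a \<Rightarrow> bool" where
  "is_unique_minimizer f P x \<longleftrightarrow> is_arg_min f P x \<and> (\<forall>y. is_arg_min f P y \<longrightarrow> y = x)"

definition supported_on :: "'n set \<Rightarrow> real ^ 'n \<Rightarrow> bool" where
  "supported_on S x \<longleftrightarrow> (\<forall>j. j \<notin> S \<longrightarrow> x $ j = 0)"

text \<open>\<open>x\<^sup>T Q x / 2\<close> for \<open>Q = diag({Q\<^sub>j})\<close> and \<open>x\<close> indexed by \<open>S\<close>.\<close>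
definition quad_cost :: "'n set \<Rightarrow> ('n \<Rightarrow> real) \<Rightarrow> real ^ 'n \<Rightarrow> real" where
  "quad_cost S Q x = (1 / 2) * (\<Sum>j\<in>S. x $ j * (Q j * x $ j))"

definition elec_cost ::
  "('b::finite, 'v::finite, 'e::finite) chp_network \<Rightarrow> (real ^ 'b) \<times> (real ^ 'b) \<times> (real ^ 'b) \<Rightarrow> real" where
  "elec_cost N = (\<lambda>(pG, pP, pU).
     quad_cost (gen_buses N) (Q_e N) pG
     + quad_cost (hp_buses N) (\<lambda>j. 1 / hp_gain N j) pP
     + quad_cost UNIV (\<lambda>j. 1 / damping N j) pU)"

definition elec_feasible ::
  "('b::finite, 'v::finite, 'e::finite) chp_network \<Rightarrow> (real ^ 'b) \<times> (real ^ 'b) \<times> (real ^ 'b) \<Rightarrow> bool" where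
  "elec_feasible N = (\<lambda>(pG, pP, pU).
     supported_on (gen_buses N) pG \<and> supported_on (hp_buses N) pP \<and>
     1 \<bullet> pG = 1 \<bullet> elec_load N + 1 \<bullet> pP + 1 \<bullet> pU)"

definition heat_cost ::
  "('b::finite, 'v::finite, 'e::finite) chp_network \<Rightarrow> real ^ 'e \<Rightarrow> real" where
  "heat_cost N = quad_cost (source_edges N) (Q_h N)"

definition heat_feasible ::
  "('b::finite, 'v::finite, 'e::finite) chp_network \<Rightarrow> real ^ 'e \<Rightarrow> real ^ 'e \<Rightarrow> bool" where
  "heat_feasible N hP hG \<longleftrightarrow>
     supported_on (source_edges N) hG \<and> 1 \<bullet> hG = 1 \<bullet> (heat_load N - hP)"

end

(*
  At an equilibrium the frequencies are constant along lines, hence equal to a single value w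
  because the network is connected. The proportional control laws then say that all marginal
  costs agree up to sign with w (with the average temperature, for the heat sources), and
  summing the balance equations, where line flows cancel and 1^T A_h = 0, gives feasibility.
  These are the Lagrange conditions of strictly convex quadratic programs, and completing the
  square shows that the equilibrium is the unique minimizer.
*)
theory Submission
  imports Defs
begin

section \<open>Separable quadratic costs under a prescribed total\<close>

lemma inner_one_vec: "1 \<bullet> (v :: real ^ 'n) = (\<Sum>j\<in>UNIV. v $ j)"
  by (simp add: inner_vec_def)

lemma inner_one_supported_on:
  assumes "supported_on S (v :: real ^ 'n)"
  shows "1 \<bullet> v = (\<Sum>j\<in>S. v $ j)"
  unfolding inner_one_vec
  using assms by (intro sum.mono_neutral_right) (auto simp: supported_on_def)

text \<open>Second-order Taylor expansion, exact because the cost is quadratic. The gradient at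
  \<open>y\<close> has the same entry \<open>l\<close> everywhere on \<open>S\<close>, so the linear
  term depends on \<open>z\<close> only through its total.\<close>

lemma quad_cost_expand_at_equal_marginals:
  fixes y z :: "real ^ 'n"
  assumes y: "supported_on S y" and z: "supported_on S z"
    and marg: "\<And>j. j \<in> S \<Longrightarrow> Q j * y $ j = l"
  shows "quad_cost S Q z = quad_cost S Q y + l * (1 \<bullet> z - 1 \<bullet> y) + quad_cost S Q (z - y)"
proof -
  \<comment> \<open>Termwise this is
    \<open>Q z^2 / 2 = Q y^2 / 2 + Q y (z - y) + Q (z - y)^2 / 2\<close>.\<close>
  have "quad_cost S Q z = quad_cost S Q y + (\<Sum>j\<in>S. Q j * y $ j * (z $ j - y $ j))
      + quad_cost S Q (z - y)"
    unfolding quad_cost_def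
    by (simp add: sum_distrib_left flip: sum.distrib, intro sum.cong refl, simp add: field_simps)
  also have "(\<Sum>j\<in>S. Q j * y $ j * (z $ j - y $ j)) = l * (\<Sum>j\<in>S. z $ j - y $ j)"
    using marg by (simp add: sum_distrib_left)
  also have "(\<Sum>j\<in>S. z $ j - y $ j) = 1 \<bullet> z - 1 \<bullet> y"
    by (simp add: inner_one_supported_on[OF y] inner_one_supported_on[OF z] sum_subtractf)
  finally show ?thesis .
qed

lemma quad_cost_nonneg:
  assumes "\<And>j. j \<in> S \<Longrightarrow> Q j > 0"
  shows "quad_cost S Q v \<ge> 0"
proof -
  have "0 \<le> v $ j * (Q j * v $ j)" if "j \<in> S" for j
    using assms[OF that] by (simp add: mult.left_commute)
  then show ?thesis
    unfolding quad_cost_def by (simp add: sum_nonneg)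
qed

text \<open>Positive weights make the form definite on vectors supported on \<open>S\<close>.
  Applied to the difference of two points, this yields uniqueness of minimizers.\<close>

lemma quad_cost_eq_0_iff:
  fixes v :: "real ^ 'n"
  assumes "\<And>j. j \<in> S \<Longrightarrow> Q j > 0" and "supported_on S v"
  shows "quad_cost S Q v = 0 \<longleftrightarrow> v = 0"
proof
  assume 0: "quad_cost S Q v = 0"
  have "0 \<le> v $ j * (Q j * v $ j)" if "j \<in> S" for j
    using assms(1)[OF that] by (simp add: mult.left_commute)
  then have "\<forall>j\<in>S. v $ j * (Q j * v $ j) = 0"
    using 0 unfolding quad_cost_def by (subst (asm) mult_eq_0_iff) (simp add: sum_nonneg_eq_0_iff)
  then have "\<forall>j\<in>S. v $ j = 0"
    using assms(1) by force
  then show "v = 0"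
    using assms(2) by (auto simp: vec_eq_iff supported_on_def)
qed (simp add: quad_cost_def)

lemma is_unique_minimizerI:
  assumes "P x" and "\<And>y. P y \<Longrightarrow> f x \<le> f y" and "\<And>y. P y \<Longrightarrow> f y = f x \<Longrightarrow> y = x"
  shows "is_unique_minimizer f P x"
  using assms unfolding is_unique_minimizer_def is_arg_min_def
  by (metis antisym not_less)

lemma supported_on_diff:
  "supported_on S u \<Longrightarrow> supported_on S v \<Longrightarrow> supported_on S (u - v)"
  by (simp add: supported_on_def)

section \<open>Connectivity and cancellation of flows on a digraph\<close>

lemma connected_imp_const:
  assumes conn: "Digraph_Component.connected (with_proj \<lparr>pverts = UNIV, parcs = R\<rparr>)"
    and edge: "\<And>i j. (i, j) \<in> R \<Longrightarrow> f i = f j"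
  shows "f u = f v"
proof -
  let ?G = "with_proj \<lparr>pverts = UNIV, parcs = R\<rparr>"
  \<comment> \<open>Connectedness is strong connectedness of the symmetric closure, so the path may
    run against the orientation of arcs; \<open>f\<close> is preserved either way.\<close>
  have "(u, v) \<in> rtrancl_on UNIV (parcs (mk_symmetric ?G))"
    using conn unfolding Digraph_Component.connected_def strongly_connected_def reachable_def
    by simp
  then show ?thesis
  proof (induct rule: rtrancl_on_induct)
    case (step y z)
    then show ?case
      using edge by (auto simp: parcs_mk_symmetric)
  qed simp
qed

text \<open>Each arc contributes its flow once at its head and once, with opposite sign, at its
  tail; exchanging the order of summation matches the two.\<close>

lemma sum_net_flow_eq_0:
  fixes f :: "'b::finite \<Rightarrow> 'b \<Rightarrow> real"
  shows "(\<Sum>j\<in>UNIV. (\<Sum>i | (i, j) \<in> R. f i j) - (\<Sum>k | (j, k) \<in> R. f j k)) = 0"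
proof -
  have "(\<Sum>j\<in>UNIV. \<Sum>i | (i, j) \<in> R. f i j) = (\<Sum>i\<in>UNIV. \<Sum>j | (i, j) \<in> R. f i j)"
    using sum.swap_restrict[of UNIV UNIV "\<lambda>j i. f i j" "\<lambda>j i. (i, j) \<in> R"] by simp
  then show ?thesis
    by (simp add: sum_subtractf)
qed

lemma inner_one_col: "1 \<bullet> col (u :: real ^ 'm) (v :: real ^ 'n) = 1 \<bullet> u + 1 \<bullet> v"
  by (simp add: inner_one_vec col_def sum.Plus flip: UNIV_Plus_UNIV)

section \<open>Consequences of the equilibrium equations\<close>

context
  fixes N :: "('b::finite, 'v::finite, 'e::finite) chp_network"
    and x :: "('b, 'v, 'e) chp_state"
  assumes wf: "chp_wf N"
    and eq: "mode1_equilibrium N x"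
begin

lemma equilibrium_freq_eq: "freq x $ i = freq x $ j"
proof (rule connected_imp_const[where f = "($) (freq x)"])
  show "Digraph_Component.connected (with_proj \<lparr>pverts = UNIV, parcs = lines N\<rparr>)"
    using wf by (simp add: chp_wf_def)
next
  fix i j assume "(i, j) \<in> lines N"
  then have "((\<lambda>s. angle x $ (i, j)) has_real_derivative freq x $ i - freq x $ j) (at 0)"
    using eq unfolding mode1_equilibrium_def mode1_solution_def by blast
  \<comment> \<open>A constant angle has derivative 0, and derivatives are unique.\<close>
  then have "freq x $ i - freq x $ j = 0"
    by (rule DERIV_unique) (rule DERIV_const)
  then show "freq x $ i = freq x $ j"
    by simp
qed

text \<open>The control law with zero derivative, multiplied by \<open>Q_e N j\<close>: the left
  side is then the marginal cost of generation, as the cost expansion needs it.\<close>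

lemma equilibrium_elec_gen:
  assumes "j \<in> gen_buses N"
  shows "Q_e N j * elec_gen x $ j = - freq x $ j"
proof -
  obtain d where d: "((\<lambda>s. elec_gen x $ j) has_real_derivative d) (at 0)"
    "tau_e N j * d = - elec_gen x $ j - (1 / Q_e N j) * freq x $ j"
    using assms eq unfolding mode1_equilibrium_def mode1_solution_def by blast
  have "d = 0"
    using d(1) by (rule DERIV_unique) (rule DERIV_const)
  moreover have "Q_e N j > 0"
    using assms wf by (simp add: chp_wf_def)
  ultimately show ?thesis
    using d(2) by (simp add: field_simps)
qed

text \<open>As for power generation; the average temperature does not depend on \<open>j\<close>, so
  all heat sources share one marginal cost.\<close>

lemma equilibrium_heat_gen:
  assumes "j \<in> source_edges N"
  shows "Q_h N j * heat_gen x $ j = - avg_temp N (temp x)"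
proof -
  obtain d where d: "((\<lambda>s. heat_gen x $ j) has_real_derivative d) (at 0)"
    "tau_h N j * d = - heat_gen x $ j - (1 / Q_h N j) * avg_temp N (temp x)"
    using assms eq unfolding mode1_equilibrium_def mode1_solution_def by blast
  have "d = 0"
    using d(1) by (rule DERIV_unique) (rule DERIV_const)
  moreover have "Q_h N j > 0"
    using assms wf by (simp add: chp_wf_def)
  ultimately show ?thesis
    using d(2) by (simp add: field_simps)
qed

lemma equilibrium_elec_feasible:
  "elec_feasible N (elec_gen x, hp_power N (freq x), damping_power N (freq x))"
proof -
  define flow where "flow = (\<lambda>i j. line_flow N (angle x) i j)"
  have bal: "elec_gen x $ j - elec_load N $ j - hp_power N (freq x) $ j
      - damping_power N (freq x) $ j
      + ((\<Sum>i | (i, j) \<in> lines N. flow i j) - (\<Sum>k | (j, k) \<in> lines N. flow j k)) = 0" for j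
  proof -
    obtain d where d:
      "j \<in> gen_buses N \<longrightarrow> ((\<lambda>s. freq x $ j) has_real_derivative d) (at 0)"
      "inertia N j * d = - elec_load N $ j - hp_power N (freq x) $ j + elec_gen x $ j
          - damping_power N (freq x) $ j + (\<Sum>i | (i, j) \<in> lines N. flow i j)
          - (\<Sum>k | (j, k) \<in> lines N. flow j k)"
      using eq unfolding mode1_equilibrium_def mode1_solution_def flow_def by blast
    \<comment> \<open>At a generator bus the constant frequency forces \<open>d = 0\<close>; at a
      load bus \<open>d\<close> is arbitrary but the inertia vanishes.\<close>
    have "inertia N j * d = 0"
    proof (cases "j \<in> gen_buses N")
      case True
      then have "((\<lambda>s. freq x $ j) has_real_derivative d) (at 0)"
        using d(1) by blast
      then have "d = 0"
        by (rule DERIV_unique) (rule DERIV_const)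
      then show ?thesis by simp
    qed (use wf in \<open>simp add: chp_wf_def\<close>)
    then show ?thesis
      using d(2) by linarith
  qed
  have "0 = (\<Sum>j\<in>UNIV. elec_gen x $ j - elec_load N $ j - hp_power N (freq x) $ j
      - damping_power N (freq x) $ j
      + ((\<Sum>i | (i, j) \<in> lines N. flow i j) - (\<Sum>k | (j, k) \<in> lines N. flow j k)))"
    by (simp only: bal sum.neutral_const)
  also have "\<dots> = 1 \<bullet> elec_gen x - 1 \<bullet> elec_load N - 1 \<bullet> hp_power N (freq x)
      - 1 \<bullet> damping_power N (freq x)"
    by (subst sum.distrib, subst sum_net_flow_eq_0) (simp add: sum_subtractf inner_one_vec)
  finally have "1 \<bullet> elec_gen x
      = 1 \<bullet> elec_load N + 1 \<bullet> hp_power N (freq x) + 1 \<bullet> damping_power N (freq x)"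
    by linarith
  moreover have "supported_on (gen_buses N) (elec_gen x)"
    using eq unfolding mode1_equilibrium_def mode1_solution_def supported_on_def by blast
  moreover have "supported_on (hp_buses N) (hp_power N (freq x))"
    by (simp add: supported_on_def hp_power_def)
  ultimately show ?thesis
    by (simp add: elec_feasible_def)
qed

lemma equilibrium_heat_feasible:
  "heat_feasible N (hp_heat N (hp_power N (freq x))) (heat_gen x)"
proof -
  let ?hP = "hp_heat N (hp_power N (freq x))"
  obtain d where d: "((\<lambda>s::real. temp x) has_vector_derivative d) (at 0)"
    "vol_matrix N *v d = - (A_h N *v temp x) + col (heat_gen x + ?hP - heat_load N) 0"
    using eq unfolding mode1_equilibrium_def mode1_solution_def by blast
  have "d = 0"
    using d(1) by (rule vector_derivative_unique_at) (rule has_vector_derivative_const)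
  with d(2) have "A_h N *v temp x = col (heat_gen x + ?hP - heat_load N) 0"
    by simp
  \<comment> \<open>The node components of the heat input are zero, so its total is that of the edge
    part.\<close>
  then have "1 \<bullet> (A_h N *v temp x) = 1 \<bullet> (heat_gen x + ?hP - heat_load N)"
    by (simp add: inner_one_col)
  \<comment> \<open>Moving \<open>A_h N\<close> onto the all-ones vector eliminates the
    temperatures: transport redistributes heat without changing its total.\<close>
  moreover have "1 \<bullet> (A_h N *v temp x) = (1 v* A_h N) \<bullet> temp x"
    by (rule dot_lmul_matrix[symmetric])
  moreover have "1 v* A_h N = 0"
    using wf by (simp add: chp_wf_def)
  ultimately have "1 \<bullet> heat_gen x = 1 \<bullet> (heat_load N - ?hP)"
    by (simp add: inner_diff_right inner_add_right)
  moreover have "supported_on (source_edges N) (heat_gen x)"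
    using eq unfolding mode1_equilibrium_def mode1_solution_def supported_on_def by blast
  ultimately show ?thesis
    by (simp add: heat_feasible_def)
qed

section \<open>Optimality and uniqueness of the equilibrium\<close>

lemma equilibrium_elec_optimal:
  "is_unique_minimizer (elec_cost N) (elec_feasible N)
     (elec_gen x, hp_power N (freq x), damping_power N (freq x))"
proof -
  define pG pP pU where "pG = elec_gen x" and "pP = hp_power N (freq x)"
    and "pU = damping_power N (freq x)"
  define G P U where "G = quad_cost (gen_buses N) (Q_e N)"
    and "P = quad_cost (hp_buses N) (\<lambda>j. 1 / hp_gain N j)"
    and "U = quad_cost UNIV (\<lambda>j. 1 / damping N j)"
  \<comment> \<open>An arbitrary reference bus; all frequencies agree.\<close>
  define w where "w = freq x $ undefined"
  have w: "freq x $ j = w" for j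
    unfolding w_def by (rule equilibrium_freq_eq)
  have pos: "\<And>j. j \<in> gen_buses N \<Longrightarrow> Q_e N j > 0"
    "\<And>j. j \<in> hp_buses N \<Longrightarrow> 1 / hp_gain N j > 0" "\<And>j. 1 / damping N j > 0"
    using wf by (simp_all add: chp_wf_def)
  have nz: "j \<in> hp_buses N \<Longrightarrow> hp_gain N j \<noteq> 0" "damping N j \<noteq> 0" for j
    using wf unfolding chp_wf_def by (metis less_irrefl)+
  \<comment> \<open>The weights of \<open>P\<close> and \<open>U\<close> are reciprocals of the
    feedback gains, which therefore cancel. Generation carries the opposite sign, as it stands
    opposite consumption in the power balance.\<close>
  have marg: "\<And>j. j \<in> gen_buses N \<Longrightarrow> Q_e N j * pG $ j = - w"
    "\<And>j. j \<in> hp_buses N \<Longrightarrow> 1 / hp_gain N j * pP $ j = w"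
    "\<And>j. 1 / damping N j * pU $ j = w"
    using equilibrium_elec_gen w nz
    by (simp_all add: pG_def pP_def pU_def hp_power_def damping_power_def)
  have feas: "elec_feasible N (pG, pP, pU)"
    unfolding pG_def pP_def pU_def by (rule equilibrium_elec_feasible)
  \<comment> \<open>The excess cost of a feasible point is the quadratic cost of its displacement:
    nonnegativity gives optimality, definiteness gives uniqueness.\<close>
  have gap: "elec_cost N (qG, qP, qU) = elec_cost N (pG, pP, pU)
      + (G (qG - pG) + P (qP - pP) + U (qU - pU))"
    if q: "elec_feasible N (qG, qP, qU)" for qG qP qU
  proof -
    have "G qG = G pG + - w * (1 \<bullet> qG - 1 \<bullet> pG) + G (qG - pG)"
      unfolding G_def using feas q marg(1)
      by (intro quad_cost_expand_at_equal_marginals) (auto simp: elec_feasible_def)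
    moreover have "P qP = P pP + w * (1 \<bullet> qP - 1 \<bullet> pP) + P (qP - pP)"
      unfolding P_def using feas q marg(2)
      by (intro quad_cost_expand_at_equal_marginals) (auto simp: elec_feasible_def)
    moreover have "U qU = U pU + w * (1 \<bullet> qU - 1 \<bullet> pU) + U (qU - pU)"
      unfolding U_def using marg(3)
      by (intro quad_cost_expand_at_equal_marginals) (auto simp: supported_on_def)
    \<comment> \<open>The difference of the two power balances; multiplied by \<open>w\<close>, it
      cancels the linear terms of the three expansions.\<close>
    moreover have "1 \<bullet> qG - 1 \<bullet> pG = (1 \<bullet> qP - 1 \<bullet> pP) + (1 \<bullet> qU - 1 \<bullet> pU)"
      using feas q by (simp add: elec_feasible_def)
    ultimately show ?thesis
      by (simp add: elec_cost_def G_def P_def U_def algebra_simps)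
  qed
  have nn: "G v \<ge> 0" "P v \<ge> 0" "U v \<ge> 0" for v
    unfolding G_def P_def U_def using pos by (simp_all add: quad_cost_nonneg)
  have "is_unique_minimizer (elec_cost N) (elec_feasible N) (pG, pP, pU)"
  proof (rule is_unique_minimizerI, rule feas)
    fix q assume q: "elec_feasible N q"
    obtain qG qP qU where [simp]: "q = (qG, qP, qU)"
      by (cases q)
    note gap = gap[OF q[simplified]]
    show "elec_cost N (pG, pP, pU) \<le> elec_cost N q"
      using gap nn(1)[of "qG - pG"] nn(2)[of "qP - pP"] nn(3)[of "qU - pU"] by simp
    assume "elec_cost N q = elec_cost N (pG, pP, pU)"
    then have 0: "G (qG - pG) = 0" "P (qP - pP) = 0" "U (qU - pU) = 0"
      using gap nn(1)[of "qG - pG"] nn(2)[of "qP - pP"] nn(3)[of "qU - pU"] by simp_all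
    have "qG - pG = 0"
      using 0(1) feas q pos(1) unfolding G_def
      by (subst (asm) quad_cost_eq_0_iff) (auto simp: elec_feasible_def intro!: supported_on_diff)
    moreover have "qP - pP = 0"
      using 0(2) feas q pos(2) unfolding P_def
      by (subst (asm) quad_cost_eq_0_iff) (auto simp: elec_feasible_def intro!: supported_on_diff)
    moreover have "qU - pU = 0"
      using 0(3) pos(3) unfolding U_def
      by (subst (asm) quad_cost_eq_0_iff) (auto simp: supported_on_def)
    ultimately show "q = (pG, pP, pU)"
      by simp
  qed
  then show ?thesis
    unfolding pG_def pP_def pU_def .
qed

text \<open>With the heat pump power fixed, all feasible points have the same total, so the linear
  term of the expansion vanishes whatever the average temperature is.\<close>

lemma equilibrium_heat_optimal:
  "is_unique_minimizer (heat_cost N) (heat_feasible N (hp_heat N (hp_power N (freq x))))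
     (heat_gen x)"
proof (rule is_unique_minimizerI, rule equilibrium_heat_feasible)
  have pos: "\<And>j. j \<in> source_edges N \<Longrightarrow> Q_h N j > 0"
    using wf by (simp add: chp_wf_def)
  fix h assume h: "heat_feasible N (hp_heat N (hp_power N (freq x))) h"
  have supp: "supported_on (source_edges N) h" "supported_on (source_edges N) (heat_gen x)"
    and total: "1 \<bullet> h = 1 \<bullet> heat_gen x"
    using h equilibrium_heat_feasible by (auto simp: heat_feasible_def)
  have gap: "heat_cost N h = heat_cost N (heat_gen x) + heat_cost N (h - heat_gen x)"
    using quad_cost_expand_at_equal_marginals[OF supp(2,1) equilibrium_heat_gen] total
    by (simp add: heat_cost_def)
  show "heat_cost N (heat_gen x) \<le> heat_cost N h"
    using gap quad_cost_nonneg[OF pos] by (simp add: heat_cost_def)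
  assume "heat_cost N h = heat_cost N (heat_gen x)"
  then have "heat_cost N (h - heat_gen x) = 0"
    using gap by simp
  then show "h = heat_gen x"
    using quad_cost_eq_0_iff[OF pos supported_on_diff[OF supp]] by (simp add: heat_cost_def)
qed

end

theorem proposition6:
  fixes N :: "('b::finite, 'v::finite, 'e::finite) chp_network"
    and x :: "('b, 'v, 'e) chp_state"
  assumes "chp_wf N"
    and "mode1_equilibrium N x"
  shows "is_unique_minimizer (elec_cost N) (elec_feasible N)
           (elec_gen x, hp_power N (freq x), damping_power N (freq x)) \<and>
         (\<forall>pG pP pU. is_unique_minimizer (elec_cost N) (elec_feasible N) (pG, pP, pU) \<longrightarrow>
           is_unique_minimizer (heat_cost N) (heat_feasible N (hp_heat N pP)) (heat_gen x))"
proof (intro conjI allI impI)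
  show opt: "is_unique_minimizer (elec_cost N) (elec_feasible N)
      (elec_gen x, hp_power N (freq x), damping_power N (freq x))"
    using assms by (rule equilibrium_elec_optimal)
  fix pG pP pU
  assume "is_unique_minimizer (elec_cost N) (elec_feasible N) (pG, pP, pU)"
  \<comment> \<open>Uniqueness identifies any minimizer of the electrical problem with the
    equilibrium, so its heat pump power is the one at equilibrium.\<close>
  with opt have "pP = hp_power N (freq x)"
    unfolding is_unique_minimizer_def by blast
  then show "is_unique_minimizer (heat_cost N) (heat_feasible N (hp_heat N pP)) (heat_gen x)"
    using equilibrium_heat_optimal[OF assms] by simp
qed

end
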